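(* Let $G$ be a group with identity element $e$. If $R=\oplus_{g\in G}R_g$ is a strongly $G$-graded ring which is $G$-controlled, then the map $$\phi: H\longmapsto R_H=\oplus_{h\in H}R_h$$ is a one-to-one correspondence (bijection) from the set of submonoids of $G$ to the set of unital subrings of $R$ containing $R_e$. In particular, if $R$ is a $G$-crossed product, then this occurs (i.e. $\phi$ is such a bijection) if $R_e$ is simple and $C_R(R_e)=Z(R_e)$.
   Context: Rings are associative and unital. For subsets $X,Y$ of a ring, $XY$ denotes the set of all finite sums of elements $xy$ with $x\in X$, $y\in Y$. A ring $R$ is $G$-graded if there are additive subgroups $R_g$ ($g\in G$) of $R$ with $R=\oplus_{g\in G}R_g$ and $R_gR_h\subseteq R_{gh}$ for all $g,h\in G$; it is strongly $G$-graded if moreover $R_gR_h=R_{gh}$ for all $g,h\in G$. Then $R_e$ is a subring of $R$ with $1_R\in R_e$, and each $R_g$ is an $R_e$-bimodule by multiplication in $R$. For $H\subseteq G$ put $R_H=\oplus_{h\in H}R_h$, with $R_\varnothing=\{0\}$; it is an $R_e$-bimodule. A submonoid of $G$ is a subset containing $e$ and closed under multiplication. A $G$-graded ring $R$ is a $G$-crossed product if for each $g\in G$ the component $R_g$ contains an element that is invertible in $R$ (such a ring is strongly $G$-graded). $C_R(R_e)$ is the set of elements of $R$ commuting with every element of $R_e$, and $Z(R_e)$ is the centre of $R_e$. The $G$-graded ring $R$ is called $G$-controlled if, for the given gradation: (1) the map $H\mapsto R_H=\oplus_{h\in H}R_h$ from the power set of $G$ to the set of all $R_e$-bimodules contained in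 $R$ (with scalar multiplication coming from the multiplication of $R$) is a bijection; and (2) for $S,T\subseteq G$, $R_S\cong R_T$ as $R_e$-bimodules if and only if $S=T$. *)

theory Defs
  imports "HOL-Algebra.Algebra"
begin

definition prod_sums :: "('r, 'm) ring_scheme \<Rightarrow> 'r set \<Rightarrow> 'r set \<Rightarrow> 'r set" where
  "prod_sums R U V =
     {finsum R (\<lambda>i. x i \<otimes>\<^bsub>R\<^esub> y i) {..<n} | (n :: nat) x y. x \<in> {..<n} \<rightarrow> U \<and> y \<in> {..<n} \<rightarrow> V}"

text \<open>Since \<^const>\<open>finsum\<close> over an infinite index set is \<open>\<zero>\<close>, infinite direct sums are expressed
  through sums over finite subsets of the index set.\<close>

definition component_sum :: "('r, 'm) ring_scheme \<Rightarrow> ('g \<Rightarrow> 'r set) \<Rightarrow> 'g set \<Rightarrow> 'r set" where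
  "component_sum R A H =
     {finsum R x F | x F. finite F \<and> F \<subseteq> H \<and> x \<in> (\<Pi> h\<in>F. A h)}"

locale graded_ring = G: group G + R: ring R
  for G :: "('g, 'k) monoid_scheme" and R :: "('r, 'm) ring_scheme" and A :: "'g \<Rightarrow> 'r set" +
  assumes component_additive_subgroup: "g \<in> carrier G \<Longrightarrow> additive_subgroup (A g) R"
    and unique_decomposition: "r \<in> carrier R \<Longrightarrow>
          \<exists>!x. x \<in> (\<Pi>\<^sub>E g\<in>carrier G. A g) \<and> finite {g \<in> carrier G. x g \<noteq> \<zero>\<^bsub>R\<^esub>} \<and>
               r = finsum R x {g \<in> carrier G. x g \<noteq> \<zero>\<^bsub>R\<^esub>}"
    and prod_components: "\<lbrakk>g \<in> carrier G; h \<in> carrier G\<rbrakk> \<Longrightarrow>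
          prod_sums R (A g) (A h) \<subseteq> A (g \<otimes>\<^bsub>G\<^esub> h)"

locale strongly_graded_ring = graded_ring +
  assumes strong: "\<lbrakk>g \<in> carrier G; h \<in> carrier G\<rbrakk> \<Longrightarrow>
          prod_sums R (A g) (A h) = A (g \<otimes>\<^bsub>G\<^esub> h)"

locale crossed_product_ring = graded_ring +
  assumes component_has_unit: "g \<in> carrier G \<Longrightarrow> A g \<inter> Units R \<noteq> {}"

text \<open>In the next two definitions the scalars come from a unital subring \<open>B\<close> of \<open>R\<close>, acting by
  multiplication in \<open>R\<close>, so that associativity, distributivity and unitality of the actions are
  inherited from \<open>R\<close>.\<close>

definition subbimodule :: "('r, 'm) ring_scheme \<Rightarrow> 'r set \<Rightarrow> 'r set \<Rightarrow> bool" where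
  "subbimodule R B M \<longleftrightarrow> additive_subgroup M R \<and>
     (\<forall>b\<in>B. \<forall>m\<in>M. b \<otimes>\<^bsub>R\<^esub> m \<in> M \<and> m \<otimes>\<^bsub>R\<^esub> b \<in> M)"

definition bimodule_isomorphic ::
  "('r, 'm) ring_scheme \<Rightarrow> 'r set \<Rightarrow> 'r set \<Rightarrow> 'r set \<Rightarrow> bool" where
  "bimodule_isomorphic R B M N \<longleftrightarrow>
     (\<exists>f. bij_betw f M N \<and>
          (\<forall>x\<in>M. \<forall>y\<in>M. f (x \<oplus>\<^bsub>R\<^esub> y) = f x \<oplus>\<^bsub>R\<^esub> f y) \<and>
          (\<forall>b\<in>B. \<forall>x\<in>M. f (b \<otimes>\<^bsub>R\<^esub> x) = b \<otimes>\<^bsub>R\<^esub> f x \<and> f (x \<otimes>\<^bsub>R\<^esub> b) = f x \<otimes>\<^bsub>R\<^esub> b))"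

definition controlled ::
  "('g, 'k) monoid_scheme \<Rightarrow> ('r, 'm) ring_scheme \<Rightarrow> ('g \<Rightarrow> 'r set) \<Rightarrow> bool" where
  "controlled G R A \<longleftrightarrow>
     bij_betw (component_sum R A) (Pow (carrier G)) {M. subbimodule R (A \<one>\<^bsub>G\<^esub>) M} \<and>
     (\<forall>S T. S \<subseteq> carrier G \<longrightarrow> T \<subseteq> carrier G \<longrightarrow>
        (bimodule_isomorphic R (A \<one>\<^bsub>G\<^esub>) (component_sum R A S) (component_sum R A T) \<longleftrightarrow> S = T))"

definition ring_centralizer :: "('r, 'm) ring_scheme \<Rightarrow> 'r set \<Rightarrow> 'r set" where
  "ring_centralizer R U = {r \<in> carrier R. \<forall>x\<in>U. r \<otimes>\<^bsub>R\<^esub> x = x \<otimes>\<^bsub>R\<^esub> r}"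

definition ring_center :: "('r, 'm) ring_scheme \<Rightarrow> 'r set" where
  "ring_center R = ring_centralizer R (carrier R)"

text \<open>The zero ring is not simple; ideals are two-sided.\<close>

definition simple_ring :: "('r, 'm) ring_scheme \<Rightarrow> bool" where
  "simple_ring R \<longleftrightarrow> ring R \<and> carrier R \<noteq> {\<zero>\<^bsub>R\<^esub>} \<and>
     (\<forall>I. ideal I R \<longrightarrow> I = {\<zero>\<^bsub>R\<^esub>} \<or> I = carrier R)"

end

theory Submission
  imports Defs
begin

text \<open>
  Write \<open>R\<^sub>H\<close> for the sum of the components indexed by \<open>H\<close>. An element lies in \<open>R\<^sub>H\<close> exactly when
  the degrees of its nonzero homogeneous components lie in \<open>H\<close>
  (\<open>component_sum_iff\<close>), so \<open>R\<^sub>H\<close> is a sub-bimodule over \<open>R\<^sub>e\<close>, and a nonzero component \<open>R\<^sub>g\<close> lies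
  in \<open>R\<^sub>H\<close> only if \<open>g \<in> H\<close>. For a submonoid \<open>H\<close>, multiplying by a homogeneous element with degree
  in \<open>H\<close> keeps degrees in \<open>H\<close>, and \<open>1 \<in> R\<^sub>e\<close>; hence \<open>R\<^sub>H\<close> is a subring containing \<open>R\<^sub>e\<close>.

  Conversely, a subring \<open>S\<close> containing \<open>R\<^sub>e\<close> is a sub-bimodule over \<open>R\<^sub>e\<close>. As soon as the
  sub-bimodules of \<open>R\<close> correspond bijectively to the subsets of \<open>G\<close>, we have \<open>S = R\<^sub>H\<close> for some
  \<open>H\<close>, and no component is zero, since the map separates \<open>{g}\<close> from the empty set. If
  \<open>g, h \<in> H\<close>, strong gradedness gives \<open>R\<^sub>g\<^sub>h = R\<^sub>g R\<^sub>h \<subseteq> S\<close>, whence \<open>gh \<in> H\<close>; so \<open>H\<close> is a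
  submonoid (\<open>submonoid_subring_correspondence\<close>). A controlled gradation has this bijection by
  definition.

  For a crossed product the bijection has to be proved. Each \<open>R\<^sub>g\<close> is generated over \<open>R\<^sub>e\<close> by a
  unit \<open>u\<close>, and is a simple bimodule because \<open>R\<^sub>e\<close> is a simple ring. Given a nonzero \<open>m\<close>
  in a sub-bimodule \<open>M\<close>, take a nonzero element of \<open>M\<close> whose support lies in that of \<open>m\<close> and is
  of minimal size, and some \<open>g\<close> in its support. Simplicity
  of \<open>R\<^sub>g\<close> allows us to replace the element by some \<open>x \<in> M\<close>, with no larger support, whose component
  of degree \<open>g\<close> is \<open>u\<close>. For \<open>b \<in> R\<^sub>e\<close> the element \<open>b x - x (u\<^sup>-\<^sup>1 b u)\<close> of \<open>M\<close> has lost the degree \<open>g\<close>,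
  so it is zero by minimality. Comparing components of degree \<open>h\<close> shows that \<open>x\<^sub>h u\<^sup>-\<^sup>1\<close> commutes
  with \<open>R\<^sub>e\<close>, so it lies in \<open>R\<^sub>e\<close>; its degree is \<open>h g\<^sup>-\<^sup>1\<close>, so \<open>x\<^sub>h = 0\<close> unless \<open>h = g\<close>. Thus
  \<open>x = u\<close> and \<open>R\<^sub>g \<subseteq> M\<close> (\<open>exists_component_in_subbimodule\<close>). Peeling off components by
  induction on the size of the support yields \<open>M = R\<^sub>H\<close> with \<open>H\<close> the set of those \<open>g\<close> for which
  \<open>R\<^sub>g \<subseteq> M\<close>.
\<close>

section \<open>Additive subgroups and sub-bimodules of a ring\<close>

lemma (in ring) additive_subgroup_iff:
  "additive_subgroup M R \<longleftrightarrow>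
     M \<subseteq> carrier R \<and> \<zero> \<in> M \<and> (\<forall>x\<in>M. \<ominus> x \<in> M) \<and> (\<forall>x\<in>M. \<forall>y\<in>M. x \<oplus> y \<in> M)"
proof
  assume "additive_subgroup M R"
  then have "subgroup M (add_monoid R)" by (rule additive_subgroup.a_subgroup)
  from subgroup.subset[OF this] subgroup.one_closed[OF this] add.subgroupE(3,4)[OF this]
  show "M \<subseteq> carrier R \<and> \<zero> \<in> M \<and> (\<forall>x\<in>M. \<ominus> x \<in> M) \<and> (\<forall>x\<in>M. \<forall>y\<in>M. x \<oplus> y \<in> M)"
    by auto
next
  assume "M \<subseteq> carrier R \<and> \<zero> \<in> M \<and> (\<forall>x\<in>M. \<ominus> x \<in> M) \<and> (\<forall>x\<in>M. \<forall>y\<in>M. x \<oplus> y \<in> M)"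
  then show "additive_subgroup M R"
    by (intro additive_subgroupI add.subgroupI) auto
qed

lemma (in ring) additive_subgroup_finsum:
  assumes "additive_subgroup M R" "finite F" "\<And>i. i \<in> F \<Longrightarrow> f i \<in> M"
  shows "finsum R f F \<in> M"
  using assms(2,3)
proof (induction rule: finite_induct)
  case empty
  then show ?case using assms(1) by (simp add: additive_subgroup_iff)
next
  case (insert i F)
  have M: "M \<subseteq> carrier R" "\<And>x y. x \<in> M \<Longrightarrow> y \<in> M \<Longrightarrow> x \<oplus> y \<in> M"
    using assms(1) by (auto simp: additive_subgroup_iff)
  have "f \<in> F \<rightarrow> carrier R" "f i \<in> carrier R" using insert.prems M by auto
  then have "finsum R f (insert i F) = f i \<oplus> finsum R f F"
    using insert.hyps by (intro finsum_insert) auto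
  then show ?case using insert M by auto
qed

lemma (in ring) subbimodule_Int:
  assumes "subbimodule R B M" "subbimodule R B N"
  shows "subbimodule R B (M \<inter> N)"
  using assms by (auto simp: subbimodule_def additive_subgroup_iff)

section \<open>Homogeneous components\<close>

context graded_ring
begin

definition proj :: "'g \<Rightarrow> 'r \<Rightarrow> 'r" where
  "proj g r = (THE x. x \<in> (\<Pi>\<^sub>E g\<in>carrier G. A g) \<and>
      finite {g \<in> carrier G. x g \<noteq> \<zero>\<^bsub>R\<^esub>} \<and>
      r = finsum R x {g \<in> carrier G. x g \<noteq> \<zero>\<^bsub>R\<^esub>}) g"

definition supp :: "'r \<Rightarrow> 'g set" where
  "supp r = {g \<in> carrier G. proj g r \<noteq> \<zero>\<^bsub>R\<^esub>}"

lemma component_subset: "g \<in> carrier G \<Longrightarrow> A g \<subseteq> carrier R"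
  and component_zero: "g \<in> carrier G \<Longrightarrow> \<zero>\<^bsub>R\<^esub> \<in> A g"
  and component_neg: "g \<in> carrier G \<Longrightarrow> x \<in> A g \<Longrightarrow> \<ominus>\<^bsub>R\<^esub> x \<in> A g"
  and component_add: "g \<in> carrier G \<Longrightarrow> x \<in> A g \<Longrightarrow> y \<in> A g \<Longrightarrow> x \<oplus>\<^bsub>R\<^esub> y \<in> A g"
  using component_additive_subgroup[of g] by (auto simp: R.additive_subgroup_iff)

lemma component_carrier: "g \<in> carrier G \<Longrightarrow> x \<in> A g \<Longrightarrow> x \<in> carrier R"
  using component_subset by blast

lemma component_mult:
  assumes "g \<in> carrier G" "h \<in> carrier G" "x \<in> A g" "y \<in> A h"
  shows "x \<otimes>\<^bsub>R\<^esub> y \<in> A (g \<otimes>\<^bsub>G\<^esub> h)"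
proof -
  have "x \<otimes>\<^bsub>R\<^esub> y \<in> carrier R" using assms component_carrier by simp
  then have "x \<otimes>\<^bsub>R\<^esub> y = finsum R (\<lambda>i. x \<otimes>\<^bsub>R\<^esub> y) {..<Suc 0}"
    by (simp add: lessThan_Suc)
  then have "x \<otimes>\<^bsub>R\<^esub> y \<in> prod_sums R (A g) (A h)"
    unfolding prod_sums_def using assms(3,4)
    by (intro CollectI exI[of _ "Suc 0"] exI[of _ "\<lambda>_. x"] exI[of _ "\<lambda>_. y"]) auto
  then show ?thesis using prod_components assms by blast
qed

lemma proj_spec:
  assumes "r \<in> carrier R"
  shows "g \<in> carrier G \<Longrightarrow> proj g r \<in> A g"
    and "finite (supp r)"
    and "finsum R (\<lambda>g. proj g r) (supp r) = r"
  using theI'[OF unique_decomposition[OF assms]]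
  by (auto simp: proj_def supp_def)

lemma proj_carrier [simp]: "r \<in> carrier R \<Longrightarrow> g \<in> carrier G \<Longrightarrow> proj g r \<in> carrier R"
  using proj_spec(1) component_carrier by blast

lemma finite_supp: "r \<in> carrier R \<Longrightarrow> finite (supp r)"
  by (rule proj_spec(2))

lemma supp_subset: "supp r \<subseteq> carrier G"
  by (auto simp: supp_def)

text \<open>Extending \<open>x\<close> by zero outside \<open>F\<close> gives a decomposition of the sum over \<open>F\<close>, so uniqueness
  of decompositions applies. The components of a given element are computed below by
  exhibiting it as such a sum.\<close>

lemma proj_unique:
  assumes F: "finite F" "F \<subseteq> carrier G" and x: "\<And>g. g \<in> F \<Longrightarrow> x g \<in> A g"
    and g: "g \<in> carrier G"
  shows "proj g (finsum R x F) = (if g \<in> F then x g else \<zero>\<^bsub>R\<^esub>)"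
proof -
  define y where "y = (\<lambda>g\<in>carrier G. if g \<in> F then x g else \<zero>\<^bsub>R\<^esub>)"
  have xF: "x \<in> F \<rightarrow> carrier R" using x F component_carrier by blast
  have sub: "{g \<in> carrier G. y g \<noteq> \<zero>\<^bsub>R\<^esub>} \<subseteq> F" by (auto simp: y_def)
  have "finsum R y {g \<in> carrier G. y g \<noteq> \<zero>\<^bsub>R\<^esub>} = finsum R x F"
    by (rule R.add.finprod_mono_neutral_cong_left)
       (use F xF in \<open>auto simp: y_def split: if_splits\<close>)
  moreover have "y \<in> (\<Pi>\<^sub>E g\<in>carrier G. A g)"
    using x component_zero by (auto simp: y_def)
  moreover have "finite {g \<in> carrier G. y g \<noteq> \<zero>\<^bsub>R\<^esub>}"
    using sub F(1) by (rule finite_subset)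
  moreover have "finsum R x F \<in> carrier R" using xF by (rule R.finsum_closed)
  ultimately have "(THE y. y \<in> (\<Pi>\<^sub>E g\<in>carrier G. A g) \<and>
      finite {g \<in> carrier G. y g \<noteq> \<zero>\<^bsub>R\<^esub>} \<and>
      finsum R x F = finsum R y {g \<in> carrier G. y g \<noteq> \<zero>\<^bsub>R\<^esub>}) = y"
    by (intro the1_equality unique_decomposition) auto
  then show ?thesis using g by (simp add: proj_def y_def)
qed

lemma finsum_proj:
  assumes "r \<in> carrier R" "finite F" "supp r \<subseteq> F" "F \<subseteq> carrier G"
  shows "finsum R (\<lambda>g. proj g r) F = r"
proof -
  have "finsum R (\<lambda>g. proj g r) (supp r) = finsum R (\<lambda>g. proj g r) F"
    by (rule R.add.finprod_mono_neutral_cong_left)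
       (use assms in \<open>auto simp: supp_def\<close>)
  then show ?thesis using proj_spec(3)[OF assms(1)] by simp
qed

lemma proj_homogeneous:
  assumes "h \<in> carrier G" "x \<in> A h" "g \<in> carrier G"
  shows "proj g x = (if g = h then x else \<zero>\<^bsub>R\<^esub>)"
proof -
  have "finsum R (\<lambda>_. x) {h} = x"
    using assms component_carrier by simp
  then show ?thesis
    using proj_unique[of "{h}" "\<lambda>_. x" g] assms by auto
qed

lemma proj_zero [simp]: "g \<in> carrier G \<Longrightarrow> proj g \<zero>\<^bsub>R\<^esub> = \<zero>\<^bsub>R\<^esub>"
  using proj_homogeneous[of g "\<zero>\<^bsub>R\<^esub>" g] component_zero by simp

lemma proj_add:
  assumes "r \<in> carrier R" "s \<in> carrier R" "g \<in> carrier G"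
  shows "proj g (r \<oplus>\<^bsub>R\<^esub> s) = proj g r \<oplus>\<^bsub>R\<^esub> proj g s"
proof -
  let ?F = "supp r \<union> supp s"
  have F: "finite ?F" "?F \<subseteq> carrier G"
    using proj_spec(2) assms by (auto simp: supp_def)
  have "finsum R (\<lambda>g. proj g r \<oplus>\<^bsub>R\<^esub> proj g s) ?F
      = finsum R (\<lambda>g. proj g r) ?F \<oplus>\<^bsub>R\<^esub> finsum R (\<lambda>g. proj g s) ?F"
    by (rule R.finsum_addf) (use F assms in auto)
  also have "\<dots> = r \<oplus>\<^bsub>R\<^esub> s"
    using F assms by (simp add: finsum_proj)
  finally have eq: "finsum R (\<lambda>g. proj g r \<oplus>\<^bsub>R\<^esub> proj g s) ?F = r \<oplus>\<^bsub>R\<^esub> s" .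
  have "proj g (finsum R (\<lambda>g. proj g r \<oplus>\<^bsub>R\<^esub> proj g s) ?F)
      = (if g \<in> ?F then proj g r \<oplus>\<^bsub>R\<^esub> proj g s else \<zero>\<^bsub>R\<^esub>)"
    by (rule proj_unique) (use F assms proj_spec(1) component_add in auto)
  also have "\<dots> = proj g r \<oplus>\<^bsub>R\<^esub> proj g s"
    using assms by (auto simp: supp_def)
  finally show ?thesis by (simp add: eq)
qed

lemma proj_neg:
  assumes "r \<in> carrier R" "g \<in> carrier G"
  shows "proj g (\<ominus>\<^bsub>R\<^esub> r) = \<ominus>\<^bsub>R\<^esub> proj g r"
proof -
  have "proj g (\<ominus>\<^bsub>R\<^esub> r) \<oplus>\<^bsub>R\<^esub> proj g r = \<zero>\<^bsub>R\<^esub>"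
    using proj_add[of "\<ominus>\<^bsub>R\<^esub> r" r g] assms by (simp add: R.l_neg)
  then show ?thesis using assms by (simp add: R.minus_equality)
qed

lemma proj_minus:
  assumes "r \<in> carrier R" "s \<in> carrier R" "g \<in> carrier G"
  shows "proj g (r \<ominus>\<^bsub>R\<^esub> s) = proj g r \<ominus>\<^bsub>R\<^esub> proj g s"
  using assms by (simp add: R.minus_eq proj_add proj_neg)

lemma proj_finsum:
  assumes "finite F" "\<And>i. i \<in> F \<Longrightarrow> f i \<in> carrier R" "g \<in> carrier G"
  shows "proj g (finsum R f F) = finsum R (\<lambda>i. proj g (f i)) F"
  using assms(1,2)
proof (induction rule: finite_induct)
  case empty
  then show ?case using assms(3) by simp
next
  case (insert i F)
  have "f \<in> F \<rightarrow> carrier R" "(\<lambda>i. proj g (f i)) \<in> F \<rightarrow> carrier R"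
    using insert.prems assms(3) by auto
  then show ?case
    using insert assms(3) by (simp add: proj_add)
qed

lemma supp_empty_iff: "r \<in> carrier R \<Longrightarrow> supp r = {} \<longleftrightarrow> r = \<zero>\<^bsub>R\<^esub>"
proof
  assume "r \<in> carrier R" "supp r = {}"
  then show "r = \<zero>\<^bsub>R\<^esub>" using proj_spec(3)[of r] by simp
qed (simp add: supp_def)

text \<open>A homogeneous factor of degree \<open>h\<close> shifts degrees by \<open>h\<close>, and \<open>hf = hg\<close> only for \<open>f = g\<close>. So
  after decomposing \<open>r\<close> a single summand survives in degree \<open>hg\<close>.\<close>

lemma proj_mult_left:
  assumes "h \<in> carrier G" "b \<in> A h" "r \<in> carrier R" "g \<in> carrier G"
  shows "proj (h \<otimes>\<^bsub>G\<^esub> g) (b \<otimes>\<^bsub>R\<^esub> r) = b \<otimes>\<^bsub>R\<^esub> proj g r"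
proof -
  \<comment> \<open>The degree \<open>g\<close> is inserted so that the sum contains the surviving summand even if it is zero.\<close>
  let ?F = "insert g (supp r)"
  have F: "finite ?F" "?F \<subseteq> carrier G" "supp r \<subseteq> ?F"
    using proj_spec(2) assms by (auto simp: supp_def)
  have b: "b \<in> carrier R" using assms component_carrier by blast
  have "b \<otimes>\<^bsub>R\<^esub> r = finsum R (\<lambda>f. b \<otimes>\<^bsub>R\<^esub> proj f r) ?F"
    using R.finsum_rdistr[OF F(1) b, of "\<lambda>f. proj f r"] F(2) assms(3)
    by (simp add: finsum_proj[OF assms(3) F(1,3,2)] Pi_def subset_iff)
  also have "proj (h \<otimes>\<^bsub>G\<^esub> g) \<dots> = finsum R (\<lambda>f. proj (h \<otimes>\<^bsub>G\<^esub> g) (b \<otimes>\<^bsub>R\<^esub> proj f r)) ?F"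
    by (rule proj_finsum) (use F assms b in auto)
  also have "\<dots> = finsum R (\<lambda>f. if g = f then b \<otimes>\<^bsub>R\<^esub> proj f r else \<zero>\<^bsub>R\<^esub>) ?F"
  proof (rule R.finsum_cong')
    fix f assume "f \<in> ?F"
    then have f: "f \<in> carrier G" using F by blast
    have "b \<otimes>\<^bsub>R\<^esub> proj f r \<in> A (h \<otimes>\<^bsub>G\<^esub> f)"
      using component_mult proj_spec(1) assms f by blast
    then show "proj (h \<otimes>\<^bsub>G\<^esub> g) (b \<otimes>\<^bsub>R\<^esub> proj f r)
        = (if g = f then b \<otimes>\<^bsub>R\<^esub> proj f r else \<zero>\<^bsub>R\<^esub>)"
      using proj_homogeneous[of "h \<otimes>\<^bsub>G\<^esub> f" _ "h \<otimes>\<^bsub>G\<^esub> g"] assms f by auto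
  qed (use F b assms in auto)
  also have "\<dots> = b \<otimes>\<^bsub>R\<^esub> proj g r"
    by (rule R.finsum_singleton) (use F b assms in auto)
  finally show ?thesis .
qed

lemma proj_mult_right:
  assumes "h \<in> carrier G" "b \<in> A h" "r \<in> carrier R" "g \<in> carrier G"
  shows "proj (g \<otimes>\<^bsub>G\<^esub> h) (r \<otimes>\<^bsub>R\<^esub> b) = proj g r \<otimes>\<^bsub>R\<^esub> b"
proof -
  let ?F = "insert g (supp r)"
  have F: "finite ?F" "?F \<subseteq> carrier G" "supp r \<subseteq> ?F"
    using proj_spec(2) assms by (auto simp: supp_def)
  have b: "b \<in> carrier R" using assms component_carrier by blast
  have "r \<otimes>\<^bsub>R\<^esub> b = finsum R (\<lambda>f. proj f r \<otimes>\<^bsub>R\<^esub> b) ?F"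
    using R.finsum_ldistr[OF F(1) b, of "\<lambda>f. proj f r"] F(2) assms(3)
    by (simp add: finsum_proj[OF assms(3) F(1,3,2)] Pi_def subset_iff)
  also have "proj (g \<otimes>\<^bsub>G\<^esub> h) \<dots> = finsum R (\<lambda>f. proj (g \<otimes>\<^bsub>G\<^esub> h) (proj f r \<otimes>\<^bsub>R\<^esub> b)) ?F"
    by (rule proj_finsum) (use F assms b in auto)
  also have "\<dots> = finsum R (\<lambda>f. if g = f then proj f r \<otimes>\<^bsub>R\<^esub> b else \<zero>\<^bsub>R\<^esub>) ?F"
  proof (rule R.finsum_cong')
    fix f assume "f \<in> ?F"
    then have f: "f \<in> carrier G" using F by blast
    have "proj f r \<otimes>\<^bsub>R\<^esub> b \<in> A (f \<otimes>\<^bsub>G\<^esub> h)"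
      using component_mult proj_spec(1) assms f by blast
    then show "proj (g \<otimes>\<^bsub>G\<^esub> h) (proj f r \<otimes>\<^bsub>R\<^esub> b)
        = (if g = f then proj f r \<otimes>\<^bsub>R\<^esub> b else \<zero>\<^bsub>R\<^esub>)"
      using proj_homogeneous[of "f \<otimes>\<^bsub>G\<^esub> h" _ "g \<otimes>\<^bsub>G\<^esub> h"] assms f by auto
  qed (use F b assms in auto)
  also have "\<dots> = proj g r \<otimes>\<^bsub>R\<^esub> b"
    by (rule R.finsum_singleton) (use F b assms in auto)
  finally show ?thesis .
qed

text \<open>Let \<open>u\<close> be the component of \<open>1\<close> in degree \<open>e\<close>. For homogeneous \<open>x\<close> of degree \<open>g\<close>, comparing
  the components of \<open>x = x 1\<close> in degree \<open>g\<close> gives \<open>x = x u\<close>. Thus \<open>u\<close> is a right identity on all of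
  \<open>R\<close>, and \<open>1 = 1 u = u\<close>.\<close>

lemma one_in_identity_component: "\<one>\<^bsub>R\<^esub> \<in> A \<one>\<^bsub>G\<^esub>"
proof -
  let ?u = "proj \<one>\<^bsub>G\<^esub> \<one>\<^bsub>R\<^esub>"
  have u: "?u \<in> A \<one>\<^bsub>G\<^esub>" "?u \<in> carrier R" by (auto intro: proj_spec(1))
  have hom: "x \<otimes>\<^bsub>R\<^esub> ?u = x" if "g \<in> carrier G" "x \<in> A g" for g x
    using proj_mult_left[of g x "\<one>\<^bsub>R\<^esub>" "\<one>\<^bsub>G\<^esub>"] proj_homogeneous[of g x g] that
      component_carrier by simp
  have fin: "finite (supp \<one>\<^bsub>R\<^esub>)" by (simp add: finite_supp)
  have "\<one>\<^bsub>R\<^esub> \<otimes>\<^bsub>R\<^esub> ?u = finsum R (\<lambda>g. proj g \<one>\<^bsub>R\<^esub>) (supp \<one>\<^bsub>R\<^esub>) \<otimes>\<^bsub>R\<^esub> ?u"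
    by (simp add: proj_spec(3))
  also have "\<dots> = finsum R (\<lambda>g. proj g \<one>\<^bsub>R\<^esub> \<otimes>\<^bsub>R\<^esub> ?u) (supp \<one>\<^bsub>R\<^esub>)"
    by (rule R.finsum_ldistr[OF fin]) (auto simp: supp_def)
  also have "\<dots> = finsum R (\<lambda>g. proj g \<one>\<^bsub>R\<^esub>) (supp \<one>\<^bsub>R\<^esub>)"
    by (rule R.finsum_cong') (auto simp: supp_def hom proj_spec(1))
  also have "\<dots> = \<one>\<^bsub>R\<^esub>" by (simp add: proj_spec(3))
  finally have "?u = \<one>\<^bsub>R\<^esub>" using u(2) by simp
  with u(1) show ?thesis by simp
qed

section \<open>Sums of components\<close>

text \<open>This description of the elements through their supports replaces the quantification over
  finite partial sums, so that closure properties become inclusions between supports.\<close>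

lemma component_sum_iff:
  assumes "H \<subseteq> carrier G"
  shows "r \<in> component_sum R A H \<longleftrightarrow> r \<in> carrier R \<and> supp r \<subseteq> H"
proof
  assume "r \<in> component_sum R A H"
  then obtain x F where F: "finite F" "F \<subseteq> H" "x \<in> (\<Pi> h\<in>F. A h)" and r: "r = finsum R x F"
    by (auto simp: component_sum_def)
  have "x \<in> F \<rightarrow> carrier R" using F assms component_carrier by blast
  moreover have "proj g r = (if g \<in> F then x g else \<zero>\<^bsub>R\<^esub>)" if "g \<in> carrier G" for g
    unfolding r by (rule proj_unique) (use F assms that in auto)
  ultimately show "r \<in> carrier R \<and> supp r \<subseteq> H"
    using F r by (auto simp: supp_def split: if_splits)
next
  assume r: "r \<in> carrier R \<and> supp r \<subseteq> H"
  then have "finite (supp r)" "r = finsum R (\<lambda>g. proj g r) (supp r)"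
      "(\<lambda>g. proj g r) \<in> (\<Pi> h\<in>supp r. A h)"
    using proj_spec by (auto simp: supp_def)
  then show "r \<in> component_sum R A H"
    unfolding component_sum_def using r by blast
qed

lemma component_sum_subbimodule:
  assumes H: "H \<subseteq> carrier G"
  shows "subbimodule R (A \<one>\<^bsub>G\<^esub>) (component_sum R A H)"
proof -
  have add: "x \<oplus>\<^bsub>R\<^esub> y \<in> component_sum R A H"
    if "x \<in> component_sum R A H" "y \<in> component_sum R A H" for x y
  proof -
    have "supp (x \<oplus>\<^bsub>R\<^esub> y) \<subseteq> supp x \<union> supp y"
      using that H by (auto simp: component_sum_iff supp_def proj_add)
    then show ?thesis using that H by (auto simp: component_sum_iff)
  qed
  have neg: "\<ominus>\<^bsub>R\<^esub> x \<in> component_sum R A H" if "x \<in> component_sum R A H" for x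
    using that H by (auto simp: component_sum_iff supp_def proj_neg)
  have zero: "\<zero>\<^bsub>R\<^esub> \<in> component_sum R A H"
    using H by (auto simp: component_sum_iff supp_def)
  have left: "b \<otimes>\<^bsub>R\<^esub> x \<in> component_sum R A H"
    and right: "x \<otimes>\<^bsub>R\<^esub> b \<in> component_sum R A H"
    if "b \<in> A \<one>\<^bsub>G\<^esub>" "x \<in> component_sum R A H" for b x
  proof -
    have b: "b \<in> carrier R" using that component_carrier by blast
    have "proj g (b \<otimes>\<^bsub>R\<^esub> x) = b \<otimes>\<^bsub>R\<^esub> proj g x" "proj g (x \<otimes>\<^bsub>R\<^esub> b) = proj g x \<otimes>\<^bsub>R\<^esub> b"
      if "g \<in> carrier G" for g
      using proj_mult_left[of "\<one>\<^bsub>G\<^esub>" b x g] proj_mult_right[of "\<one>\<^bsub>G\<^esub>" b x g] that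
        \<open>b \<in> A \<one>\<^bsub>G\<^esub>\<close> \<open>x \<in> component_sum R A H\<close> H by (auto simp: component_sum_iff)
    then have "supp (b \<otimes>\<^bsub>R\<^esub> x) \<subseteq> supp x" "supp (x \<otimes>\<^bsub>R\<^esub> b) \<subseteq> supp x"
      using b by (auto simp: supp_def)
    then show "b \<otimes>\<^bsub>R\<^esub> x \<in> component_sum R A H" "x \<otimes>\<^bsub>R\<^esub> b \<in> component_sum R A H"
      using that b H by (auto simp: component_sum_iff)
  qed
  show ?thesis
    unfolding subbimodule_def R.additive_subgroup_iff
    using add neg zero left right H by (auto simp: component_sum_iff)
qed

lemma component_subset_component_sum:
  assumes "H \<subseteq> carrier G" "h \<in> H"
  shows "A h \<subseteq> component_sum R A H"
proof
  fix x assume x: "x \<in> A h"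
  have h: "h \<in> carrier G" using assms by blast
  have "supp x \<subseteq> {h}"
    using proj_homogeneous[OF h x] by (auto simp: supp_def split: if_split_asm)
  then show "x \<in> component_sum R A H"
    using assms component_carrier[OF h x] component_sum_iff by blast
qed

lemma component_subset_component_sum_iff:
  assumes "H \<subseteq> carrier G" "g \<in> carrier G" "A g \<noteq> {\<zero>\<^bsub>R\<^esub>}"
  shows "A g \<subseteq> component_sum R A H \<longleftrightarrow> g \<in> H"
proof
  assume sub: "A g \<subseteq> component_sum R A H"
  obtain x where x: "x \<in> A g" "x \<noteq> \<zero>\<^bsub>R\<^esub>"
    using assms(3) component_zero[OF assms(2)] by blast
  have "g \<in> supp x" using x assms proj_homogeneous[of g x g] by (auto simp: supp_def)
  then show "g \<in> H" using x(1) sub component_sum_iff[OF assms(1)] by blast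
qed (use assms component_subset_component_sum in blast)

lemma component_sum_least:
  assumes "additive_subgroup M R" "H \<subseteq> carrier G" "\<And>h. h \<in> H \<Longrightarrow> A h \<subseteq> M"
  shows "component_sum R A H \<subseteq> M"
proof
  fix r assume "r \<in> component_sum R A H"
  then have "r \<in> carrier R" "supp r \<subseteq> H" using component_sum_iff[OF assms(2)] by auto
  then have "finsum R (\<lambda>g. proj g r) (supp r) \<in> M"
    using proj_spec(1) assms(2,3)
    by (intro R.additive_subgroup_finsum[OF assms(1)] finite_supp) blast+
  then show "r \<in> M" using \<open>r \<in> carrier R\<close> by (simp add: proj_spec(3))
qed

lemma component_sum_singleton:
  assumes "g \<in> carrier G"
  shows "component_sum R A {g} = A g"
  using component_sum_least[OF component_additive_subgroup[OF assms], of "{g}"]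
    component_subset_component_sum[of "{g}" g] assms by blast

lemma component_sum_empty: "component_sum R A {} = {\<zero>\<^bsub>R\<^esub>}"
  using component_sum_iff[of "{}"] supp_empty_iff by (auto simp: supp_def)

section \<open>Submonoids and subrings\<close>

lemma component_sum_subring:
  assumes "submonoid H G"
  shows "subring (component_sum R A H) R"
proof -
  interpret H: submonoid H G by fact
  have sub: "H \<subseteq> carrier G" by (rule H.subset)
  have grp: "additive_subgroup (component_sum R A H) R"
    using component_sum_subbimodule[OF sub] by (simp add: subbimodule_def)
  \<comment> \<open>It suffices to multiply by a homogeneous element \<open>a\<close> of degree \<open>h \<in> H\<close>: every degree \<open>k\<close> in
     the product is \<open>h\<close> times a degree of \<open>y\<close>.\<close>
  have hom: "a \<otimes>\<^bsub>R\<^esub> y \<in> component_sum R A H"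
    if h: "h \<in> H" and a: "a \<in> A h" and y: "y \<in> component_sum R A H" for h a y
  proof -
    have hG: "h \<in> carrier G" using h sub by blast
    have carr: "a \<in> carrier R" "y \<in> carrier R" "supp y \<subseteq> H"
      using hG a y sub component_carrier by (auto simp: component_sum_iff)
    have "k \<in> H" if "k \<in> supp (a \<otimes>\<^bsub>R\<^esub> y)" for k
    proof -
      let ?k' = "inv\<^bsub>G\<^esub> h \<otimes>\<^bsub>G\<^esub> k"
      have k: "k \<in> carrier G" using that by (simp add: supp_def)
      then have k': "?k' \<in> carrier G" "h \<otimes>\<^bsub>G\<^esub> ?k' = k"
        using hG by (auto simp flip: G.m_assoc)
      have "proj k (a \<otimes>\<^bsub>R\<^esub> y) = a \<otimes>\<^bsub>R\<^esub> proj ?k' y"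
        using proj_mult_left[OF hG a carr(2) k'(1)] k' by simp
      then have "?k' \<in> supp y" using that k' carr by (auto simp: supp_def)
      then show "k \<in> H" using carr h k' H.m_closed by fastforce
    qed
    then show ?thesis using carr sub by (auto simp: component_sum_iff)
  qed
  show ?thesis
  proof (rule R.subringI)
    fix x y assume x: "x \<in> component_sum R A H" and y: "y \<in> component_sum R A H"
    have xc: "x \<in> carrier R" "supp x \<subseteq> H" and yc: "y \<in> carrier R"
      using x y sub by (auto simp: component_sum_iff)
    have "x \<otimes>\<^bsub>R\<^esub> y = finsum R (\<lambda>g. proj g x) (supp x) \<otimes>\<^bsub>R\<^esub> y"
      using xc by (simp add: proj_spec(3))
    also have "\<dots> = finsum R (\<lambda>g. proj g x \<otimes>\<^bsub>R\<^esub> y) (supp x)"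
      using xc yc by (intro R.finsum_ldistr finite_supp) (auto simp: supp_def)
    also have "\<dots> \<in> component_sum R A H"
    proof (rule R.additive_subgroup_finsum[OF grp])
      fix g assume "g \<in> supp x"
      then show "proj g x \<otimes>\<^bsub>R\<^esub> y \<in> component_sum R A H"
        using hom[of g] xc y sub proj_spec(1)[of x g] by blast
    qed (use xc proj_spec(2) in blast)
    finally show "x \<otimes>\<^bsub>R\<^esub> y \<in> component_sum R A H" .
  next
    show "\<one>\<^bsub>R\<^esub> \<in> component_sum R A H"
      using component_subset_component_sum[OF sub H.one_closed] one_in_identity_component by blast
  qed (use grp in \<open>auto simp: R.additive_subgroup_iff\<close>)
qed

lemma subring_subbimodule:
  assumes "subring S R" "A \<one>\<^bsub>G\<^esub> \<subseteq> S"
  shows "subbimodule R (A \<one>\<^bsub>G\<^esub>) S"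
  using subringE[OF assms(1)] assms(2)
  by (auto simp: subbimodule_def R.additive_subgroup_iff)

end

text \<open>Injectivity is inherited from the given bijection, and so is the shape \<open>R\<^sub>H\<close> of any subring
  containing \<open>R\<^sub>e\<close>. Strong gradedness is what forces \<open>H\<close> to be closed under products: without it
  \<open>R\<^sub>g R\<^sub>h\<close> might be a proper part of \<open>R\<^sub>g\<^sub>h\<close> and would not place \<open>R\<^sub>g\<^sub>h\<close> inside the subring.\<close>

theorem (in strongly_graded_ring) submonoid_subring_correspondence:
  assumes bij: "bij_betw (component_sum R A) (Pow (carrier G)) {M. subbimodule R (A \<one>\<^bsub>G\<^esub>) M}"
  shows "bij_betw (component_sum R A) {H. submonoid H G} {S. subring S R \<and> A \<one>\<^bsub>G\<^esub> \<subseteq> S}"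
proof -
  have inj: "inj_on (component_sum R A) (Pow (carrier G))"
    using bij by (rule bij_betw_imp_inj_on)
  have nz: "A g \<noteq> {\<zero>\<^bsub>R\<^esub>}" if g: "g \<in> carrier G" for g
    using inj_onD[OF inj, of "{g}" "{}"] g
    by (auto simp: component_sum_singleton component_sum_empty)
  have "component_sum R A ` {H. submonoid H G} = {S. subring S R \<and> A \<one>\<^bsub>G\<^esub> \<subseteq> S}"
  proof (intro equalityI subsetI)
    fix S assume "S \<in> component_sum R A ` {H. submonoid H G}"
    then obtain H where H: "submonoid H G" "S = component_sum R A H" by blast
    then show "S \<in> {S. subring S R \<and> A \<one>\<^bsub>G\<^esub> \<subseteq> S}"
      using component_sum_subring[OF H(1)]
        component_subset_component_sum[OF submonoid.subset[OF H(1)] submonoid.one_closed[OF H(1)]]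
      by simp
  next
    fix S assume "S \<in> {S. subring S R \<and> A \<one>\<^bsub>G\<^esub> \<subseteq> S}"
    then have S: "subring S R" "A \<one>\<^bsub>G\<^esub> \<subseteq> S" by auto
    then obtain H where H: "H \<subseteq> carrier G" and SH: "S = component_sum R A H"
      using bij_betw_imp_surj_on[OF bij] subring_subbimodule by blast
    have "submonoid H G"
    proof
      show "H \<subseteq> carrier G" by fact
      show "\<one>\<^bsub>G\<^esub> \<in> H"
        using S SH H nz component_subset_component_sum_iff by blast
      fix g h assume gh: "g \<in> H" "h \<in> H"
      then have ghG: "g \<in> carrier G" "h \<in> carrier G" using H by auto
      have AS: "A g \<subseteq> S" "A h \<subseteq> S"
        using gh H SH component_subset_component_sum by auto
      have grp: "additive_subgroup S R"
        using subring_subbimodule[OF S] by (simp add: subbimodule_def)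
      have "prod_sums R (A g) (A h) \<subseteq> S"
        unfolding prod_sums_def
        using AS subringE(6)[OF S(1)] by (auto simp: Pi_iff subset_iff intro!: R.additive_subgroup_finsum[OF grp])
      then have "A (g \<otimes>\<^bsub>G\<^esub> h) \<subseteq> component_sum R A H"
        using strong[OF ghG] SH by simp
      then show "g \<otimes>\<^bsub>G\<^esub> h \<in> H"
        using component_subset_component_sum_iff[OF H _ nz] ghG by simp
    qed
    then show "S \<in> component_sum R A ` {H. submonoid H G}"
      unfolding SH by (intro imageI CollectI)
  qed
  moreover have "inj_on (component_sum R A) {H. submonoid H G}"
    by (rule inj_on_subset[OF inj]) (auto dest: submonoid.subset)
  ultimately show ?thesis by (simp add: bij_betw_def)
qed

section \<open>Crossed products\<close>

text \<open>The component \<open>w\<close> of the inverse in degree \<open>g\<^sup>-\<^sup>1\<close> already satisfies \<open>u w = 1\<close>, as one sees by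
  comparing the components of \<open>u u\<^sup>-\<^sup>1 = 1\<close> in degree \<open>e\<close>.\<close>

lemma (in graded_ring) inverse_of_homogeneous_unit:
  assumes g: "g \<in> carrier G" and u: "u \<in> A g" "u \<in> Units R"
  shows "inv\<^bsub>R\<^esub> u \<in> A (inv\<^bsub>G\<^esub> g)"
proof -
  let ?v = "inv\<^bsub>R\<^esub> u" and ?w = "proj (inv\<^bsub>G\<^esub> g) (inv\<^bsub>R\<^esub> u)"
  have carr: "u \<in> carrier R" "?v \<in> carrier R" "?w \<in> carrier R"
    using u(2) g by auto
  have "u \<otimes>\<^bsub>R\<^esub> ?w = proj (g \<otimes>\<^bsub>G\<^esub> inv\<^bsub>G\<^esub> g) (u \<otimes>\<^bsub>R\<^esub> ?v)"
    using proj_mult_left[of g u ?v "inv\<^bsub>G\<^esub> g"] g u carr by simp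
  also have "\<dots> = \<one>\<^bsub>R\<^esub>"
    using g u(2) proj_homogeneous[OF _ one_in_identity_component, of "\<one>\<^bsub>G\<^esub>"] by simp
  finally have "u \<otimes>\<^bsub>R\<^esub> ?w = u \<otimes>\<^bsub>R\<^esub> ?v" using u(2) by simp
  then have "?v = ?w" using R.Units_l_cancel[OF u(2) carr(3,2)] by simp
  then show ?thesis using proj_spec(1)[of ?v "inv\<^bsub>G\<^esub> g"] g carr by simp
qed

lemma (in graded_ring) conjugate_in_identity_component:
  assumes g: "g \<in> carrier G" and "b \<in> A \<one>\<^bsub>G\<^esub>" "u \<in> A g" "v \<in> A (inv\<^bsub>G\<^esub> g)"
  shows "v \<otimes>\<^bsub>R\<^esub> b \<otimes>\<^bsub>R\<^esub> u \<in> A \<one>\<^bsub>G\<^esub>"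
proof -
  have "v \<otimes>\<^bsub>R\<^esub> b \<in> A (inv\<^bsub>G\<^esub> g)"
    using component_mult[of "inv\<^bsub>G\<^esub> g" "\<one>\<^bsub>G\<^esub>" v b] assms by simp
  then show ?thesis
    using component_mult[of "inv\<^bsub>G\<^esub> g" g "v \<otimes>\<^bsub>R\<^esub> b" u] assms by simp
qed

lemma (in graded_ring) subbimodule_proj_image:
  assumes M: "subbimodule R (A \<one>\<^bsub>G\<^esub>) M" and g: "g \<in> carrier G"
  shows "subbimodule R (A \<one>\<^bsub>G\<^esub>) (proj g ` M)"
proof -
  have carr: "\<And>x. x \<in> M \<Longrightarrow> x \<in> carrier R" and zero: "\<zero>\<^bsub>R\<^esub> \<in> M"
    and neg: "\<And>x. x \<in> M \<Longrightarrow> \<ominus>\<^bsub>R\<^esub> x \<in> M"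
    and add: "\<And>x y. x \<in> M \<Longrightarrow> y \<in> M \<Longrightarrow> x \<oplus>\<^bsub>R\<^esub> y \<in> M"
    and scal: "\<And>b x. b \<in> A \<one>\<^bsub>G\<^esub> \<Longrightarrow> x \<in> M \<Longrightarrow> b \<otimes>\<^bsub>R\<^esub> x \<in> M"
      "\<And>b x. b \<in> A \<one>\<^bsub>G\<^esub> \<Longrightarrow> x \<in> M \<Longrightarrow> x \<otimes>\<^bsub>R\<^esub> b \<in> M"
    using M by (auto simp: subbimodule_def R.additive_subgroup_iff)
  have "\<zero>\<^bsub>R\<^esub> \<in> proj g ` M"
    using zero g proj_zero by (metis imageI)
  moreover have "\<ominus>\<^bsub>R\<^esub> proj g x \<in> proj g ` M" if "x \<in> M" for x
    using neg[OF that] proj_neg[of x g] g carr[OF that] by (metis imageI)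
  moreover have "proj g x \<oplus>\<^bsub>R\<^esub> proj g y \<in> proj g ` M" if "x \<in> M" "y \<in> M" for x y
    using add[OF that] proj_add[of x y g] g carr that by (metis imageI)
  moreover have "b \<otimes>\<^bsub>R\<^esub> proj g x \<in> proj g ` M" if "b \<in> A \<one>\<^bsub>G\<^esub>" "x \<in> M" for b x
    using scal(1)[OF that] proj_mult_left[of "\<one>\<^bsub>G\<^esub>" b x g] g carr that
    by (metis imageI G.l_one G.one_closed)
  moreover have "proj g x \<otimes>\<^bsub>R\<^esub> b \<in> proj g ` M" if "b \<in> A \<one>\<^bsub>G\<^esub>" "x \<in> M" for b x
    using scal(2)[OF that] proj_mult_right[of "\<one>\<^bsub>G\<^esub>" b x g] g carr that
    by (metis imageI G.r_one G.one_closed)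
  moreover have "proj g ` M \<subseteq> carrier R" using carr g by auto
  ultimately show ?thesis
    by (auto simp: subbimodule_def R.additive_subgroup_iff)
qed

context crossed_product_ring
begin

lemma homogeneous_unit:
  assumes g: "g \<in> carrier G"
  obtains u v where "u \<in> A g" "v \<in> A (inv\<^bsub>G\<^esub> g)" "u \<in> carrier R" "v \<in> carrier R"
    "u \<otimes>\<^bsub>R\<^esub> v = \<one>\<^bsub>R\<^esub>" "v \<otimes>\<^bsub>R\<^esub> u = \<one>\<^bsub>R\<^esub>"
proof -
  obtain u where u: "u \<in> A g" "u \<in> Units R"
    using component_has_unit[OF g] by blast
  show ?thesis
    by (rule that[of u "inv\<^bsub>R\<^esub> u"]) (use u g inverse_of_homogeneous_unit in auto)
qed

text \<open>If \<open>u\<close> is a unit of degree \<open>g\<close>, then every \<open>r\<close> of degree \<open>gh\<close> is the single product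
  \<open>u (u\<^sup>-\<^sup>1 r)\<close>.\<close>

lemma strongly_graded: "strongly_graded_ring G R A"
proof
  fix g h assume g: "g \<in> carrier G" and h: "h \<in> carrier G"
  have "A (g \<otimes>\<^bsub>G\<^esub> h) \<subseteq> prod_sums R (A g) (A h)"
  proof
    fix r assume r: "r \<in> A (g \<otimes>\<^bsub>G\<^esub> h)"
    obtain u v where u: "u \<in> A g" "v \<in> A (inv\<^bsub>G\<^esub> g)" "u \<in> carrier R" "v \<in> carrier R"
        "u \<otimes>\<^bsub>R\<^esub> v = \<one>\<^bsub>R\<^esub>"
      using homogeneous_unit[OF g] by metis
    have rc: "r \<in> carrier R" using r g h component_carrier by blast
    have "v \<otimes>\<^bsub>R\<^esub> r \<in> A (inv\<^bsub>G\<^esub> g \<otimes>\<^bsub>G\<^esub> (g \<otimes>\<^bsub>G\<^esub> h))"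
      using component_mult u r g h by simp
    then have vr: "v \<otimes>\<^bsub>R\<^esub> r \<in> A h" using g h by (simp flip: G.m_assoc)
    have "u \<otimes>\<^bsub>R\<^esub> (v \<otimes>\<^bsub>R\<^esub> r) = r" using u rc by (simp flip: R.m_assoc)
    then have "r = finsum R (\<lambda>i. u \<otimes>\<^bsub>R\<^esub> (v \<otimes>\<^bsub>R\<^esub> r)) {..<Suc 0}"
      using rc by (simp add: lessThan_Suc)
    then show "r \<in> prod_sums R (A g) (A h)"
      unfolding prod_sums_def using u vr
      by (intro CollectI exI[of _ "Suc 0"] exI[of _ "\<lambda>_. u"] exI[of _ "\<lambda>_. v \<otimes>\<^bsub>R\<^esub> r"]) auto
  qed
  then show "prod_sums R (A g) (A h) = A (g \<otimes>\<^bsub>G\<^esub> h)"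
    using prod_components[OF g h] by blast
qed

lemma component_generated_by_unit:
  assumes g: "g \<in> carrier G" and M: "subbimodule R (A \<one>\<^bsub>G\<^esub>) M"
    and u: "u \<in> M" and uv: "u \<in> A g" "v \<in> A (inv\<^bsub>G\<^esub> g)" "v \<otimes>\<^bsub>R\<^esub> u = \<one>\<^bsub>R\<^esub>"
  shows "A g \<subseteq> M"
proof
  fix a assume a: "a \<in> A g"
  have "a \<otimes>\<^bsub>R\<^esub> v \<in> A \<one>\<^bsub>G\<^esub>" using component_mult[of g "inv\<^bsub>G\<^esub> g" a v] g a uv by simp
  then have "(a \<otimes>\<^bsub>R\<^esub> v) \<otimes>\<^bsub>R\<^esub> u \<in> M" using M u by (simp add: subbimodule_def)
  moreover have "a \<in> carrier R" "u \<in> carrier R" "v \<in> carrier R"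
    using a uv g component_carrier by (blast, blast, simp add: component_carrier[of "inv\<^bsub>G\<^esub> g"])
  ultimately show "a \<in> M" using uv by (simp add: R.m_assoc)
qed

section \<open>Sub-bimodules of a crossed product\<close>

text \<open>For a unit \<open>u\<close> of degree \<open>g\<close>, the elements \<open>x\<close> of \<open>R\<^sub>e\<close> with \<open>x u \<in> N\<close> form a two-sided ideal \<open>I\<close>
  of \<open>R\<^sub>e\<close>. It contains \<open>n u\<^sup>-\<^sup>1\<close> for each \<open>n \<in> N\<close>, so it is nonzero because \<open>N\<close> is. By simplicity \<open>1 \<in> I\<close>, that is
  \<open>u \<in> N\<close>, and \<open>u\<close> generates \<open>R\<^sub>g\<close>.\<close>

lemma component_simple:
  assumes simple: "simple_ring (R\<lparr>carrier := A \<one>\<^bsub>G\<^esub>\<rparr>)"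
    and g: "g \<in> carrier G" and N: "subbimodule R (A \<one>\<^bsub>G\<^esub>) N" "N \<subseteq> A g" "N \<noteq> {\<zero>\<^bsub>R\<^esub>}"
  shows "N = A g"
proof -
  let ?B = "R\<lparr>carrier := A \<one>\<^bsub>G\<^esub>\<rparr>"
  interpret B: ring ?B using simple by (simp add: simple_ring_def)
  obtain u v where u: "u \<in> A g" "v \<in> A (inv\<^bsub>G\<^esub> g)" "u \<in> carrier R" "v \<in> carrier R"
      "u \<otimes>\<^bsub>R\<^esub> v = \<one>\<^bsub>R\<^esub>" "v \<otimes>\<^bsub>R\<^esub> u = \<one>\<^bsub>R\<^esub>"
    using homogeneous_unit[OF g] by metis
  have Bc: "\<And>b. b \<in> A \<one>\<^bsub>G\<^esub> \<Longrightarrow> b \<in> carrier R" using component_carrier by blast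
  have N': "N \<subseteq> carrier R" "\<zero>\<^bsub>R\<^esub> \<in> N" "\<And>x. x \<in> N \<Longrightarrow> \<ominus>\<^bsub>R\<^esub> x \<in> N"
      "\<And>x y. x \<in> N \<Longrightarrow> y \<in> N \<Longrightarrow> x \<oplus>\<^bsub>R\<^esub> y \<in> N"
      "\<And>b x. b \<in> A \<one>\<^bsub>G\<^esub> \<Longrightarrow> x \<in> N \<Longrightarrow> b \<otimes>\<^bsub>R\<^esub> x \<in> N"
      "\<And>b x. b \<in> A \<one>\<^bsub>G\<^esub> \<Longrightarrow> x \<in> N \<Longrightarrow> x \<otimes>\<^bsub>R\<^esub> b \<in> N"
    using N(1) by (auto simp: subbimodule_def R.additive_subgroup_iff)
  define I where "I = {x \<in> A \<one>\<^bsub>G\<^esub>. x \<otimes>\<^bsub>R\<^esub> u \<in> N}"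
  \<comment> \<open>Negation in the ring with restricted carrier is defined by a description over that carrier,
     so its agreement with negation in \<open>R\<close> needs proof.\<close>
  have negB: "\<ominus>\<^bsub>?B\<^esub> x = \<ominus>\<^bsub>R\<^esub> x" if "x \<in> A \<one>\<^bsub>G\<^esub>" for x
    using B.minus_equality[of "\<ominus>\<^bsub>R\<^esub> x" x] that component_neg Bc by (simp add: R.l_neg)
  have "additive_subgroup I ?B"
    unfolding B.additive_subgroup_iff using u(3) Bc N'
    by (auto simp: I_def negB component_neg component_zero component_add R.l_distr R.l_minus)
  moreover have "b \<otimes>\<^bsub>R\<^esub> x \<in> I" if "x \<in> I" "b \<in> A \<one>\<^bsub>G\<^esub>" for b x
    using that u(3) Bc N'(5) component_mult[of "\<one>\<^bsub>G\<^esub>" "\<one>\<^bsub>G\<^esub>" b x]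
    by (auto simp: I_def R.m_assoc)
  moreover have "x \<otimes>\<^bsub>R\<^esub> b \<in> I" if "x \<in> I" "b \<in> A \<one>\<^bsub>G\<^esub>" for b x
  proof -
    have x: "x \<in> A \<one>\<^bsub>G\<^esub>" "x \<otimes>\<^bsub>R\<^esub> u \<in> N" using that by (auto simp: I_def)
    \<comment> \<open>Right multiplication by \<open>b\<close> passes through \<open>u\<close> as multiplication by the conjugate of \<open>b\<close>,
       which still has degree \<open>e\<close>.\<close>
    have "v \<otimes>\<^bsub>R\<^esub> b \<otimes>\<^bsub>R\<^esub> u \<in> A \<one>\<^bsub>G\<^esub>"
      using conjugate_in_identity_component[OF g that(2) u(1,2)] .
    then have "x \<otimes>\<^bsub>R\<^esub> u \<otimes>\<^bsub>R\<^esub> (v \<otimes>\<^bsub>R\<^esub> b \<otimes>\<^bsub>R\<^esub> u) \<in> N"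
      using x(2) N'(6) by blast
    moreover have "x \<otimes>\<^bsub>R\<^esub> u \<otimes>\<^bsub>R\<^esub> (v \<otimes>\<^bsub>R\<^esub> b \<otimes>\<^bsub>R\<^esub> u) = x \<otimes>\<^bsub>R\<^esub> (u \<otimes>\<^bsub>R\<^esub> v) \<otimes>\<^bsub>R\<^esub> b \<otimes>\<^bsub>R\<^esub> u"
      using x that u(3,4) Bc by (simp add: R.m_assoc)
    ultimately show ?thesis
      using x that u(5) Bc component_mult[of "\<one>\<^bsub>G\<^esub>" "\<one>\<^bsub>G\<^esub>" x b] by (simp add: I_def)
  qed
  ultimately have "ideal I ?B"
    by (intro idealI B.ring_axioms additive_subgroup.a_subgroup) auto
  then have "I = {\<zero>\<^bsub>R\<^esub>} \<or> I = A \<one>\<^bsub>G\<^esub>"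
    using simple by (simp add: simple_ring_def)
  moreover have "I \<noteq> {\<zero>\<^bsub>R\<^esub>}"
  proof -
    obtain n where n: "n \<in> N" "n \<noteq> \<zero>\<^bsub>R\<^esub>" using N(3) N'(2) by blast
    have nc: "n \<in> carrier R" using n N'(1) by blast
    have nvu: "n \<otimes>\<^bsub>R\<^esub> v \<otimes>\<^bsub>R\<^esub> u = n" using nc u by (simp add: R.m_assoc)
    have "n \<otimes>\<^bsub>R\<^esub> v \<in> A \<one>\<^bsub>G\<^esub>"
      using component_mult[of g "inv\<^bsub>G\<^esub> g" n v] n(1) N(2) g u by auto
    then have "n \<otimes>\<^bsub>R\<^esub> v \<in> I" using n nvu by (simp add: I_def)
    moreover have "n \<otimes>\<^bsub>R\<^esub> v \<noteq> \<zero>\<^bsub>R\<^esub>" using nvu n(2) u(3) by auto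
    ultimately show ?thesis by blast
  qed
  ultimately have "\<one>\<^bsub>R\<^esub> \<in> I" using one_in_identity_component by simp
  then have "u \<in> N" using u(3) by (simp add: I_def)
  then show ?thesis
    using component_generated_by_unit[OF g N(1) _ u(1,2,6)] N(2) by blast
qed

text \<open>The heart of the crossed product case. A nonzero element of minimal support inside that of \<open>m\<close> is
  compared with its own multiples by \<open>R\<^sub>e\<close>: the twisted commutators \<open>b x - x (u\<^sup>-\<^sup>1 b u)\<close> vanish, so the coefficients
  of \<open>x\<close> relative to \<open>u\<close> centralize \<open>R\<^sub>e\<close>, and the assumption on the centralizer leaves only the
  coefficient of degree \<open>e\<close>. The degree found lies in the support of the given \<open>m\<close>, so that it
  can be removed from \<open>m\<close>.\<close>

lemma exists_component_in_subbimodule: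
  assumes simple: "simple_ring (R\<lparr>carrier := A \<one>\<^bsub>G\<^esub>\<rparr>)"
    and centralizer: "ring_centralizer R (A \<one>\<^bsub>G\<^esub>) \<subseteq> A \<one>\<^bsub>G\<^esub>"
    and M: "subbimodule R (A \<one>\<^bsub>G\<^esub>) M" and m: "m \<in> M" "m \<noteq> \<zero>\<^bsub>R\<^esub>"
  shows "\<exists>g \<in> supp m. A g \<subseteq> M"
proof -
  have Mc: "M \<subseteq> carrier R" and Mminus: "\<And>x y. x \<in> M \<Longrightarrow> y \<in> M \<Longrightarrow> x \<ominus>\<^bsub>R\<^esub> y \<in> M"
    and scal: "\<And>b x. b \<in> A \<one>\<^bsub>G\<^esub> \<Longrightarrow> x \<in> M \<Longrightarrow> b \<otimes>\<^bsub>R\<^esub> x \<in> M"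
      "\<And>b x. b \<in> A \<one>\<^bsub>G\<^esub> \<Longrightarrow> x \<in> M \<Longrightarrow> x \<otimes>\<^bsub>R\<^esub> b \<in> M"
    using M by (auto simp: subbimodule_def R.additive_subgroup_iff R.minus_eq)
  have "\<exists>n. (n \<in> M \<and> n \<noteq> \<zero>\<^bsub>R\<^esub> \<and> supp n \<subseteq> supp m) \<and>
      (\<forall>y. y \<in> M \<and> y \<noteq> \<zero>\<^bsub>R\<^esub> \<and> supp y \<subseteq> supp m \<longrightarrow> card (supp n) \<le> card (supp y))"
    by (rule ex_has_least_nat[of _ m]) (use m in simp)
  then obtain n where n: "n \<in> M" "n \<noteq> \<zero>\<^bsub>R\<^esub>" "supp n \<subseteq> supp m"
    and least: "\<And>y. y \<in> M \<Longrightarrow> y \<noteq> \<zero>\<^bsub>R\<^esub> \<Longrightarrow> supp y \<subseteq> supp m \<Longrightarrow> card (supp n) \<le> card (supp y)"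
    by blast
  have nc: "n \<in> carrier R" using n(1) Mc by blast
  obtain g where g: "g \<in> supp n" using supp_empty_iff[OF nc] n(2) by blast
  then have gG: "g \<in> carrier G" and pgn: "proj g n \<noteq> \<zero>\<^bsub>R\<^esub>" by (auto simp: supp_def)
  obtain u v where u: "u \<in> A g" "v \<in> A (inv\<^bsub>G\<^esub> g)" "u \<in> carrier R" "v \<in> carrier R"
      "u \<otimes>\<^bsub>R\<^esub> v = \<one>\<^bsub>R\<^esub>" "v \<otimes>\<^bsub>R\<^esub> u = \<one>\<^bsub>R\<^esub>"
    using homogeneous_unit[OF gG] by metis
  \<comment> \<open>Restricting to elements supported in the support of \<open>n\<close> keeps minimality available after \<open>n\<close> is
     traded for an element whose component of degree \<open>g\<close> is the unit \<open>u\<close>.\<close>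
  let ?M = "M \<inter> component_sum R A (supp n)"
  have "proj g ` ?M = A g"
  proof (rule component_simple[OF simple gG])
    show "subbimodule R (A \<one>\<^bsub>G\<^esub>) (proj g ` ?M)"
      by (intro subbimodule_proj_image R.subbimodule_Int M component_sum_subbimodule supp_subset gG)
    show "proj g ` ?M \<subseteq> A g" using Mc gG proj_spec(1) by blast
    have "n \<in> ?M" using n(1) nc by (simp add: component_sum_iff supp_subset)
    then show "proj g ` ?M \<noteq> {\<zero>\<^bsub>R\<^esub>}" using pgn by blast
  qed
  with u(1) have "u \<in> proj g ` ?M" by simp
  then obtain x where x: "x \<in> M" "supp x \<subseteq> supp n" "u = proj g x"
    by (auto simp: component_sum_iff supp_subset)
  have xc: "x \<in> carrier R" using x(1) Mc by blast
  have twist: "b \<otimes>\<^bsub>R\<^esub> proj h x = proj h x \<otimes>\<^bsub>R\<^esub> (v \<otimes>\<^bsub>R\<^esub> b \<otimes>\<^bsub>R\<^esub> u)"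
    if b: "b \<in> A \<one>\<^bsub>G\<^esub>" and h: "h \<in> carrier G" for b h
  proof -
    let ?c = "v \<otimes>\<^bsub>R\<^esub> b \<otimes>\<^bsub>R\<^esub> u"
    let ?y = "b \<otimes>\<^bsub>R\<^esub> x \<ominus>\<^bsub>R\<^esub> x \<otimes>\<^bsub>R\<^esub> ?c"
    have bc: "b \<in> carrier R" using b component_carrier by blast
    have c: "?c \<in> A \<one>\<^bsub>G\<^esub>"
      using conjugate_in_identity_component[OF gG b u(1,2)] .
    have cc: "?c \<in> carrier R" using u bc by simp
    have yM: "?y \<in> M" using Mminus scal b c x(1) by blast
    have projy: "proj k ?y = b \<otimes>\<^bsub>R\<^esub> proj k x \<ominus>\<^bsub>R\<^esub> proj k x \<otimes>\<^bsub>R\<^esub> ?c" if k: "k \<in> carrier G" for k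
      using proj_minus[of "b \<otimes>\<^bsub>R\<^esub> x" "x \<otimes>\<^bsub>R\<^esub> ?c" k] proj_mult_left[OF _ b xc k]
        proj_mult_right[OF _ c xc k] bc cc xc k by simp
    have "u \<otimes>\<^bsub>R\<^esub> ?c = u \<otimes>\<^bsub>R\<^esub> v \<otimes>\<^bsub>R\<^esub> b \<otimes>\<^bsub>R\<^esub> u" using u(3,4) bc by (simp add: R.m_assoc)
    also have "\<dots> = b \<otimes>\<^bsub>R\<^esub> u" using u(3,5) bc by simp
    finally have "proj g ?y = \<zero>\<^bsub>R\<^esub>"
      using projy[OF gG] x(3) u(3) bc by (simp add: R.minus_eq R.r_neg)
    moreover have "supp ?y \<subseteq> supp x"
      using projy bc cc by (auto simp: supp_def R.minus_eq)
    ultimately have "supp ?y \<subset> supp n" using x(2) g by (auto simp: supp_def)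
    moreover from this have "card (supp ?y) < card (supp n)"
      by (intro psubset_card_mono finite_supp nc)
    ultimately have "?y = \<zero>\<^bsub>R\<^esub>" using least[OF yM] n(3) by fastforce
    then have "b \<otimes>\<^bsub>R\<^esub> proj h x \<ominus>\<^bsub>R\<^esub> proj h x \<otimes>\<^bsub>R\<^esub> ?c = \<zero>\<^bsub>R\<^esub>" using projy[OF h] h by simp
    then show ?thesis using bc cc xc h by (simp add: R.r_right_minus_eq)
  qed
  have "proj h x = \<zero>\<^bsub>R\<^esub>" if h: "h \<in> carrier G" "h \<noteq> g" for h
  proof -
    let ?c = "proj h x \<otimes>\<^bsub>R\<^esub> v" and ?k = "h \<otimes>\<^bsub>G\<^esub> inv\<^bsub>G\<^esub> g"
    have pc: "proj h x \<in> carrier R" using xc h by simp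
    have "?c \<otimes>\<^bsub>R\<^esub> b = b \<otimes>\<^bsub>R\<^esub> ?c" if b: "b \<in> A \<one>\<^bsub>G\<^esub>" for b
    proof -
      have bc: "b \<in> carrier R" using b component_carrier by blast
      have "b \<otimes>\<^bsub>R\<^esub> ?c = proj h x \<otimes>\<^bsub>R\<^esub> (v \<otimes>\<^bsub>R\<^esub> b \<otimes>\<^bsub>R\<^esub> u) \<otimes>\<^bsub>R\<^esub> v"
        using twist[OF b h(1)] bc pc u(4) by (simp flip: R.m_assoc)
      also have "\<dots> = ?c \<otimes>\<^bsub>R\<^esub> b \<otimes>\<^bsub>R\<^esub> (u \<otimes>\<^bsub>R\<^esub> v)"
        using bc pc u(3,4) by (simp add: R.m_assoc)
      also have "\<dots> = ?c \<otimes>\<^bsub>R\<^esub> b" using bc pc u(4,5) by simp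
      finally show ?thesis by simp
    qed
    then have "?c \<in> A \<one>\<^bsub>G\<^esub>"
      using centralizer pc u(4) by (auto simp: ring_centralizer_def)
    moreover have "?c \<in> A ?k"
      using component_mult proj_spec(1) xc u(2) h(1) gG by simp
    \<comment> \<open>An element that is homogeneous of two different degrees is zero.\<close>
    moreover have "?k \<noteq> \<one>\<^bsub>G\<^esub>"
      using h gG G.inv_equality[of h "inv\<^bsub>G\<^esub> g"] by auto
    ultimately have "?c = \<zero>\<^bsub>R\<^esub>"
      using proj_homogeneous[of "\<one>\<^bsub>G\<^esub>" ?c ?k] proj_homogeneous[of ?k ?c ?k] h(1) gG by simp
    then have "\<zero>\<^bsub>R\<^esub> = ?c \<otimes>\<^bsub>R\<^esub> u" using u(3) by simp
    also have "\<dots> = proj h x" using pc u by (simp add: R.m_assoc)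
    finally show ?thesis by simp
  qed
  then have "supp x \<subseteq> {g}" by (auto simp: supp_def)
  then have "finsum R (\<lambda>h. proj h x) {g} = x" using xc gG by (intro finsum_proj) auto
  then have "x = u" using x(3) u(3) by simp
  then have "A g \<subseteq> M" using component_generated_by_unit[OF gG M _ u(1,2,6)] x(1) by blast
  then show ?thesis using g n(3) by blast
qed

text \<open>Each nonzero \<open>m \<in> M\<close> has some \<open>R\<^sub>g \<subseteq> M\<close> with \<open>g\<close> in its support; subtracting its component of degree \<open>g\<close>
  stays in \<open>M\<close> and shrinks the support, so by induction every degree of \<open>m\<close> is of this kind.\<close>

lemma subbimodule_eq_component_sum:
  assumes simple: "simple_ring (R\<lparr>carrier := A \<one>\<^bsub>G\<^esub>\<rparr>)"
    and centralizer: "ring_centralizer R (A \<one>\<^bsub>G\<^esub>) \<subseteq> A \<one>\<^bsub>G\<^esub>"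
    and M: "subbimodule R (A \<one>\<^bsub>G\<^esub>) M"
  shows "M = component_sum R A {g \<in> carrier G. A g \<subseteq> M}"
proof
  let ?H = "{g \<in> carrier G. A g \<subseteq> M}"
  have H: "?H \<subseteq> carrier G" by blast
  have Mc: "M \<subseteq> carrier R" and Mminus: "\<And>x y. x \<in> M \<Longrightarrow> y \<in> M \<Longrightarrow> x \<ominus>\<^bsub>R\<^esub> y \<in> M"
    using M by (auto simp: subbimodule_def R.additive_subgroup_iff R.minus_eq)
  show "component_sum R A ?H \<subseteq> M"
    by (rule component_sum_least) (use M in \<open>auto simp: subbimodule_def\<close>)
  show "M \<subseteq> component_sum R A ?H"
  proof
    fix m assume "m \<in> M"
    then show "m \<in> component_sum R A ?H"
    proof (induction "card (supp m)" arbitrary: m rule: less_induct)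
      case less
      have mc: "m \<in> carrier R" using less.prems Mc by blast
      have "supp m \<subseteq> ?H"
      proof (cases "m = \<zero>\<^bsub>R\<^esub>")
        case True
        then show ?thesis by (auto simp: supp_def)
      next
        case False
        then obtain g where g: "g \<in> supp m" "A g \<subseteq> M"
          using exists_component_in_subbimodule[OF simple centralizer M less.prems] by blast
        let ?x = "m \<ominus>\<^bsub>R\<^esub> proj g m"
        have gG: "g \<in> carrier G" using g(1) supp_subset by blast
        have pg: "proj g m \<in> A g" using proj_spec(1)[OF mc gG] .
        have projx: "proj h ?x = (if h = g then \<zero>\<^bsub>R\<^esub> else proj h m)" if "h \<in> carrier G" for h
          using proj_minus[of m "proj g m" h] proj_homogeneous[OF gG pg that] mc gG that
          by (simp add: R.minus_eq R.r_neg)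
        have suppx: "supp ?x = supp m - {g}" using projx by (auto simp: supp_def split: if_split_asm)
        have "card (supp ?x) < card (supp m)"
          unfolding suppx using g(1) finite_supp[OF mc] by (intro card_Diff1_less)
        moreover have "?x \<in> M" using Mminus less.prems pg g(2) by blast
        ultimately have "supp ?x \<subseteq> ?H"
          using less.hyps component_sum_iff[OF H] by blast
        then show ?thesis using suppx g(2) gG by auto
      qed
      then show ?case using mc component_sum_iff[OF H] by blast
    qed
  qed
qed

text \<open>Surjectivity is the previous lemma. For injectivity, \<open>g \<in> H\<close> can be read off from \<open>R\<^sub>g \<subseteq> R\<^sub>H\<close>
  provided that \<open>R\<^sub>g\<close> is nonzero. A component contains a unit, so it could vanish
  only in the zero ring, where \<open>R\<^sub>e\<close> would not be simple.\<close>

theorem component_sum_bij_subbimodules: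
  assumes simple: "simple_ring (R\<lparr>carrier := A \<one>\<^bsub>G\<^esub>\<rparr>)"
    and centralizer: "ring_centralizer R (A \<one>\<^bsub>G\<^esub>) \<subseteq> A \<one>\<^bsub>G\<^esub>"
  shows "bij_betw (component_sum R A) (Pow (carrier G)) {M. subbimodule R (A \<one>\<^bsub>G\<^esub>) M}"
proof (rule bij_betw_imageI)
  have nz: "A g \<noteq> {\<zero>\<^bsub>R\<^esub>}" if g: "g \<in> carrier G" for g
  proof
    assume Ag: "A g = {\<zero>\<^bsub>R\<^esub>}"
    obtain u v where "u \<in> A g" "v \<in> carrier R" "u \<otimes>\<^bsub>R\<^esub> v = \<one>\<^bsub>R\<^esub>"
      using homogeneous_unit[OF g] by metis
    then have "\<one>\<^bsub>R\<^esub> = \<zero>\<^bsub>R\<^esub>" using Ag by auto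
    then have "carrier R = {\<zero>\<^bsub>R\<^esub>}" by (rule R.one_zeroD)
    then have "A \<one>\<^bsub>G\<^esub> = {\<zero>\<^bsub>R\<^esub>}"
      using component_subset[of "\<one>\<^bsub>G\<^esub>"] component_zero[of "\<one>\<^bsub>G\<^esub>"] by auto
    then show False using simple by (simp add: simple_ring_def)
  qed
  show "inj_on (component_sum R A) (Pow (carrier G))"
  proof (rule inj_onI)
    fix S T assume ST: "S \<in> Pow (carrier G)" "T \<in> Pow (carrier G)"
      and eq: "component_sum R A S = component_sum R A T"
    have "g \<in> S \<longleftrightarrow> g \<in> T" if "g \<in> carrier G" for g
      using component_subset_component_sum_iff[of S g] component_subset_component_sum_iff[of T g]
        ST eq that nz[OF that] by simp
    then show "S = T" using ST by blast
  qed
  show "component_sum R A ` Pow (carrier G) = {M. subbimodule R (A \<one>\<^bsub>G\<^esub>) M}"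
  proof (intro equalityI subsetI)
    fix M assume "M \<in> {M. subbimodule R (A \<one>\<^bsub>G\<^esub>) M}"
    then have "M = component_sum R A {g \<in> carrier G. A g \<subseteq> M}"
      using subbimodule_eq_component_sum[OF simple centralizer] by blast
    then show "M \<in> component_sum R A ` Pow (carrier G)" by blast
  qed (use component_sum_subbimodule in auto)
qed

end

section \<open>The correspondence\<close>

theorem proposition5p1:
  fixes G :: "('g, 'k) monoid_scheme" and R :: "('r, 'm) ring_scheme" and A :: "'g \<Rightarrow> 'r set"
  shows "(strongly_graded_ring G R A \<and> controlled G R A \<longrightarrow>
            bij_betw (component_sum R A)
              {H. submonoid H G} {S. subring S R \<and> A \<one>\<^bsub>G\<^esub> \<subseteq> S}) \<and>
         (crossed_product_ring G R A \<and>
            simple_ring (R\<lparr>carrier := A \<one>\<^bsub>G\<^esub>\<rparr>) \<and>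
            ring_centralizer R (A \<one>\<^bsub>G\<^esub>) = ring_center (R\<lparr>carrier := A \<one>\<^bsub>G\<^esub>\<rparr>) \<longrightarrow>
            bij_betw (component_sum R A)
              {H. submonoid H G} {S. subring S R \<and> A \<one>\<^bsub>G\<^esub> \<subseteq> S})"
proof (intro conjI impI; elim conjE)
  assume "strongly_graded_ring G R A" "controlled G R A"
  then show "bij_betw (component_sum R A)
      {H. submonoid H G} {S. subring S R \<and> A \<one>\<^bsub>G\<^esub> \<subseteq> S}"
    by (intro strongly_graded_ring.submonoid_subring_correspondence) (auto simp: controlled_def)
next
  assume crossed: "crossed_product_ring G R A"
    and simple: "simple_ring (R\<lparr>carrier := A \<one>\<^bsub>G\<^esub>\<rparr>)"
    and "ring_centralizer R (A \<one>\<^bsub>G\<^esub>) = ring_center (R\<lparr>carrier := A \<one>\<^bsub>G\<^esub>\<rparr>)"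
  then have centralizer: "ring_centralizer R (A \<one>\<^bsub>G\<^esub>) \<subseteq> A \<one>\<^bsub>G\<^esub>"
    by (auto simp: ring_center_def ring_centralizer_def)
  show "bij_betw (component_sum R A)
      {H. submonoid H G} {S. subring S R \<and> A \<one>\<^bsub>G\<^esub> \<subseteq> S}"
    by (intro strongly_graded_ring.submonoid_subring_correspondence
        crossed_product_ring.strongly_graded
        crossed_product_ring.component_sum_bij_subbimodules crossed simple centralizer)
qed

end
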